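(* Let $A\in\mathbb{R}^{m\times n}$, let $f:\mathbb{R}^m\to\mathbb{R}$ and $g:\mathbb{R}^n\to\mathbb{R}\cup\{+\infty\}$ be proper, closed and convex, and let $\alpha>0$ be such that $f$ is differentiable on $\mathbb{R}^m$ with $\|\nabla f(z)-\nabla f(z')\|_2\le \alpha^{-1}\|z-z'\|_2$ for all $z,z'\in\mathbb{R}^m$. Let $P(x)=f(Ax)+g(x)$ and $D(u)=-f^*(-u)-g^*(A^{\top}u)$, and assume $P$ has at least one minimizer over $\mathbb{R}^n$. Then for every $(x,u)\in\mathrm{dom}(P)\times\mathrm{dom}(-D)$, $$\mathcal{B}_{\mathrm{RYU}}(x,u)\subseteq \mathcal{B}(c_{x\text{-}\mathrm{GAP}},r_{x\text{-}\mathrm{GAP}}),\qquad c_{x\text{-}\mathrm{GAP}}=-\nabla f(Ax),\quad r_{x\text{-}\mathrm{GAP}}=\sqrt{\frac{2\,(P(x)-D(u))}{\alpha}}.$$ Moreover, the inclusion is strict whenever the pair $(x,u)$ is not optimal (i.e. unless $x$ minimizes $P$ and $u$ maximizes $D$).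
   Context: $h^*(z^* )=\sup_z \langle z^*,z\rangle-h(z)$ denotes the convex conjugate of $h$, and $\mathrm{dom}(h)=\{z: h(z)<+\infty\}$. $\mathcal{B}(c,r)=\{v\in\mathbb{R}^m:\|v-c\|_2\le r\}$ for $r\ge 0$. The RYU ball is $\mathcal{B}_{\mathrm{RYU}}(x,u)=\mathcal{B}(c_{\mathrm{RYU}},r_{\mathrm{RYU}})$ with $c_{\mathrm{RYU}}=\frac12(u-\nabla f(Ax))$ and $r_{\mathrm{RYU}}=\sqrt{\frac{P(x)-D(u)}{\alpha}-\frac{\|u+\nabla f(Ax)\|_2^2}{4}}$; the quantity under the square root is nonnegative under the stated assumptions. *)

theory Defs
  imports "HOL-Analysis.Analysis"
begin

text \<open>
  Extended-real-valued functions on a Euclidean space take values in \<^typ>\<open>ereal\<close>; a real-valued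
  function \<^term>\<open>f\<close> is regarded as one via \<^term>\<open>\<lambda>z. ereal (f z)\<close>.
\<close>

definition edom :: "('a \<Rightarrow> ereal) \<Rightarrow> 'a set" where
  "edom h = {z. h z < \<infinity>}"

definition ext_epigraph :: "('a \<Rightarrow> ereal) \<Rightarrow> ('a \<times> real) set" where
  "ext_epigraph h = {(z, t). h z \<le> ereal t}"

definition proper_fun :: "('a \<Rightarrow> ereal) \<Rightarrow> bool" where
  "proper_fun h \<longleftrightarrow> (\<forall>z. h z \<noteq> -\<infinity>) \<and> edom h \<noteq> {}"

definition closed_fun :: "('a::topological_space \<Rightarrow> ereal) \<Rightarrow> bool" where
  "closed_fun h \<longleftrightarrow> closed (ext_epigraph h)"

definition convex_fun :: "('a::real_vector \<Rightarrow> ereal) \<Rightarrow> bool" where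
  "convex_fun h \<longleftrightarrow> convex (ext_epigraph h)"

definition conjugate :: "('a::real_inner \<Rightarrow> ereal) \<Rightarrow> 'a \<Rightarrow> ereal" where
  "conjugate h w = (SUP z. ereal (inner w z) - h z)"

text \<open>Meaningful only at points where \<^term>\<open>f\<close> is differentiable.\<close>

definition grad :: "('a::real_inner \<Rightarrow> real) \<Rightarrow> 'a \<Rightarrow> 'a" where
  "grad f z = (THE d. GDERIV f z :> d)"

definition primal :: "real^'n^'m \<Rightarrow> (real^'m \<Rightarrow> real) \<Rightarrow> (real^'n \<Rightarrow> ereal) \<Rightarrow> real^'n \<Rightarrow> ereal" where
  "primal A f g x = ereal (f (A *v x)) + g x"

text \<open>
  For proper \<^term>\<open>g\<close> neither conjugate takes the value \<open>-\<infinity>\<close>, so the difference below is never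
  of the form \<open>\<infinity> - \<infinity>\<close>.
\<close>

definition dual :: "real^'n^'m \<Rightarrow> (real^'m \<Rightarrow> real) \<Rightarrow> (real^'n \<Rightarrow> ereal) \<Rightarrow> real^'m \<Rightarrow> ereal" where
  "dual A f g u = - conjugate (\<lambda>z. ereal (f z)) (- u) - conjugate g (transpose A *v u)"

text \<open>
  On \<open>dom P \<times> dom (-D)\<close> both \<open>P x\<close> and \<open>D u\<close> are finite, so the conversion to \<^typ>\<open>real\<close> is exact.
\<close>

definition duality_gap ::
  "real^'n^'m \<Rightarrow> (real^'m \<Rightarrow> real) \<Rightarrow> (real^'n \<Rightarrow> ereal) \<Rightarrow> real^'n \<Rightarrow> real^'m \<Rightarrow> real" where
  "duality_gap A f g x u = real_of_ereal (primal A f g x - dual A f g u)"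

definition c_RYU :: "real^'n^'m \<Rightarrow> (real^'m \<Rightarrow> real) \<Rightarrow> real^'n \<Rightarrow> real^'m \<Rightarrow> real^'m" where
  "c_RYU A f x u = (1/2) *\<^sub>R (u - grad f (A *v x))"

text \<open>
  Under the standing assumptions the radicand is nonnegative, so the odd extension of \<^term>\<open>sqrt\<close>
  to negative arguments plays no role.
\<close>

definition r_RYU ::
  "real^'n^'m \<Rightarrow> (real^'m \<Rightarrow> real) \<Rightarrow> (real^'n \<Rightarrow> ereal) \<Rightarrow> real \<Rightarrow> real^'n \<Rightarrow> real^'m \<Rightarrow> real" where
  "r_RYU A f g \<alpha> x u =
     sqrt (duality_gap A f g x u / \<alpha> - (norm (u + grad f (A *v x)))\<^sup>2 / 4)"

definition ball_RYU ::
  "real^'n^'m \<Rightarrow> (real^'m \<Rightarrow> real) \<Rightarrow> (real^'n \<Rightarrow> ereal) \<Rightarrow> real \<Rightarrow> real^'n \<Rightarrow> real^'m \<Rightarrow> (real^'m) set" where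
  "ball_RYU A f g \<alpha> x u = cball (c_RYU A f x u) (r_RYU A f g \<alpha> x u)"

definition c_xGAP :: "real^'n^'m \<Rightarrow> (real^'m \<Rightarrow> real) \<Rightarrow> real^'n \<Rightarrow> real^'m" where
  "c_xGAP A f x = - grad f (A *v x)"

definition r_xGAP ::
  "real^'n^'m \<Rightarrow> (real^'m \<Rightarrow> real) \<Rightarrow> (real^'n \<Rightarrow> ereal) \<Rightarrow> real \<Rightarrow> real^'n \<Rightarrow> real^'m \<Rightarrow> real" where
  "r_xGAP A f g \<alpha> x u = sqrt (2 * duality_gap A f g x u / \<alpha>)"

end

theory Submission
  imports Defs
begin

text \<open>
  Write \<open>d = u + \<nabla>f (A x)\<close> and \<open>G = P x - D u\<close>. The descent lemma turns the Fenchel--Young inequality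
  for \<open>f\<close> into \<open>G \<ge> (\<alpha>/2) \<parallel>d\<parallel>\<^sup>2\<close>, so the radicand of \<open>r\<^sub>R\<^sub>Y\<^sub>U\<close> is nonnegative. The two centers are at
  distance \<open>a = \<parallel>d\<parallel>/2\<close> and \<open>a\<^sup>2 + r\<^sub>R\<^sub>Y\<^sub>U\<^sup>2 = G/\<alpha>\<close>, whence \<open>(a + r\<^sub>R\<^sub>Y\<^sub>U)\<^sup>2 \<le> 2 G/\<alpha>\<close>, which is the inclusion.
  Equality of the balls forces \<open>d = 0\<close> and equal radii, hence \<open>G = 0\<close>, and then weak duality makes
  \<open>(x, u)\<close> optimal.
\<close>

text \<open>\<open>grad\<close> is a definite description, so both existence and uniqueness of the
  vector are needed: existence is the Riesz representation of the derivative, uniqueness comes from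
  testing two candidates on their difference.\<close>

lemma GDERIV_grad:
  fixes f :: "'a::euclidean_space \<Rightarrow> real"
  assumes "f differentiable (at z)"
  shows "GDERIV f z :> grad f z"
proof -
  from assms obtain f' where f': "(f has_derivative f') (at z)"
    unfolding differentiable_def by blast
  define d where "d = (\<Sum>b\<in>Basis. f' b *\<^sub>R b)"
  have "f' = (\<lambda>h. inner h d)"
  proof
    fix h
    have "f' h = f' (\<Sum>b\<in>Basis. inner h b *\<^sub>R b)"
      by (simp add: euclidean_representation)
    also have "\<dots> = (\<Sum>b\<in>Basis. inner h b *\<^sub>R f' b)"
      using has_derivative_linear[OF f'] by (simp add: linear_sum linear_scale)
    also have "\<dots> = inner h d"
      by (simp add: d_def inner_sum_right mult.commute)
    finally show "f' h = inner h d" .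
  qed
  with f' have d: "GDERIV f z :> d"
    by (simp add: gderiv_def)
  have "e = d" if "GDERIV f z :> e" for e
  proof -
    have "(\<lambda>h. inner h e) = (\<lambda>h. inner h d)"
      using that d unfolding gderiv_def by (rule has_derivative_unique)
    then have "inner (e - d) e = inner (e - d) d"
      by meson
    then have "inner (e - d) (e - d) = 0"
      by (simp add: inner_diff_right)
    then show ?thesis by simp
  qed
  with d show ?thesis
    unfolding grad_def by (rule theI)
qed

lemma descent_lemma:
  fixes f :: "'a::euclidean_space \<Rightarrow> real"
  assumes diff: "f differentiable_on UNIV"
    and lip: "\<And>z z'. norm (grad f z - grad f z') \<le> L * norm (z - z')"
  shows "f (z + h) \<le> f z + inner (grad f z) h + L / 2 * (norm h)\<^sup>2"
proof -
  \<comment> \<open>\<open>\<phi>\<close> is \<open>f\<close> along the segment minus the linear and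
    quadratic terms of its upper model. The claim is \<open>\<phi> 1 \<le> \<phi> 0\<close>, so a
    nonpositive derivative on \<open>0 \<le> t\<close> suffices.\<close>
  define \<phi> where
    "\<phi> t = f (z + t *\<^sub>R h) - t * inner (grad f z) h - L / 2 * t\<^sup>2 * (norm h)\<^sup>2" for t :: real
  have "\<exists>y. (\<phi> has_real_derivative y) (at t) \<and> y \<le> 0" if "0 \<le> t" for t
  proof -
    let ?p = "z + t *\<^sub>R h"
    have f': "(f has_derivative (\<lambda>k. inner k (grad f ?p))) (at ?p)"
      using GDERIV_grad[of f ?p] diff
      by (simp add: gderiv_def differentiable_on_def)
    have "((\<lambda>t. z + t *\<^sub>R h) has_derivative (\<lambda>s. s *\<^sub>R h)) (at t)"
      by (auto intro!: derivative_eq_intros)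
    from has_derivative_compose[OF this f']
    have "((\<lambda>t. f (z + t *\<^sub>R h)) has_real_derivative inner h (grad f ?p)) (at t)"
      by (simp add: has_field_derivative_def mult.commute[of _ "inner _ _"])
    then have "(\<phi> has_real_derivative
        (inner h (grad f ?p) - inner (grad f z) h - L * t * (norm h)\<^sup>2)) (at t)"
      unfolding \<phi>_def by (auto intro!: derivative_eq_intros)
    moreover have "inner h (grad f ?p) - inner (grad f z) h \<le> L * t * (norm h)\<^sup>2"
    proof -
      have "inner h (grad f ?p) - inner (grad f z) h = inner (grad f ?p - grad f z) h"
        by (simp add: inner_diff_left inner_diff_right inner_commute)
      also have "\<dots> \<le> norm (grad f ?p - grad f z) * norm h"
        by (rule norm_cauchy_schwarz)
      also have "\<dots> \<le> L * norm (?p - z) * norm h"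
        by (intro mult_right_mono lip) simp
      also have "\<dots> = L * t * (norm h)\<^sup>2"
        using that by (simp add: power2_eq_square)
      finally show ?thesis .
    qed
    ultimately show ?thesis by (intro exI conjI) auto
  qed
  then have "\<phi> 1 \<le> \<phi> 0"
    by (intro DERIV_nonpos_imp_nonincreasing[of 0 1 \<phi>]) auto
  then show ?thesis by (simp add: \<phi>_def)
qed

lemma fenchel_young: "ereal (inner w z) - h z \<le> conjugate h w"
  unfolding conjugate_def by (rule SUP_upper) simp

lemma conjugate_not_MInfty:
  assumes "proper_fun h"
  shows "conjugate h w \<noteq> -\<infinity>"
proof -
  from assms obtain z where "h z < \<infinity>" "h z \<noteq> -\<infinity>"
    by (auto simp: proper_fun_def edom_def)
  then show ?thesis
    using fenchel_young[of w z h] by (cases "h z") auto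
qed

text \<open>Plain Fenchel--Young tests the supremum in the conjugate at \<open>z\<close>; testing it
  at a shifted point gains the quadratic term.\<close>

lemma fenchel_young_smooth:
  fixes f :: "'a::euclidean_space \<Rightarrow> real"
  assumes "f differentiable_on UNIV" and "\<alpha> > 0"
    and "\<And>z z'. norm (grad f z - grad f z') \<le> (1 / \<alpha>) * norm (z - z')"
  shows "ereal (inner w z - f z + \<alpha> / 2 * (norm (w - grad f z))\<^sup>2) \<le> conjugate (\<lambda>z. ereal (f z)) w"
proof -
  \<comment> \<open>this \<open>h\<close> maximizes the lower bound on \<open>\<langle>w, z + h\<rangle> - f (z + h)\<close> given by the descent lemma\<close>
  define h where "h = \<alpha> *\<^sub>R (w - grad f z)"
  have "f (z + h) \<le> f z + inner (grad f z) h + (1 / \<alpha>) / 2 * (norm h)\<^sup>2"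
    by (rule descent_lemma) (use assms in auto)
  moreover have "(1 / \<alpha>) / 2 * (norm h)\<^sup>2 = \<alpha> / 2 * (norm (w - grad f z))\<^sup>2"
    using \<open>\<alpha> > 0\<close> by (simp add: h_def power2_eq_square)
  moreover have "inner w h - inner (grad f z) h = \<alpha> * (norm (w - grad f z))\<^sup>2"
    by (simp add: h_def power2_norm_eq_inner inner_diff_left right_diff_distrib)
  ultimately have "inner w z - f z + \<alpha> / 2 * (norm (w - grad f z))\<^sup>2 \<le> inner w (z + h) - f (z + h)"
    by (simp add: inner_add_right)
  then have "ereal (inner w z - f z + \<alpha> / 2 * (norm (w - grad f z))\<^sup>2)
      \<le> ereal (inner w (z + h)) - ereal (f (z + h))"
    by simp
  also have "\<dots> \<le> conjugate (\<lambda>z. ereal (f z)) w"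
    by (rule fenchel_young)
  finally show ?thesis .
qed

text \<open>Sum of the Fenchel--Young inequalities for \<open>f\<close> at
  \<open>(A *v y, - v)\<close> and for \<open>g\<close> at \<open>(y, transpose A *v v)\<close>; the
  inner products cancel by adjointness.\<close>

lemma weak_duality:
  assumes "proper_fun g"
  shows "dual A f g v \<le> primal A f g y"
proof -
  let ?F = "conjugate (\<lambda>z. ereal (f z)) (- v)" and ?H = "conjugate g (v v* A)"
  \<comment> \<open>With \<open>-\<infinity>\<close> excluded, the case split below meets no
    indeterminate sum of infinities.\<close>
  have "g y \<noteq> -\<infinity>" "?F \<noteq> -\<infinity>" "?H \<noteq> -\<infinity>"
    using assms conjugate_not_MInfty[OF assms]
      conjugate_not_MInfty[of "\<lambda>z. ereal (f z)" "- v"]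
    by (auto simp: proper_fun_def edom_def)
  then show ?thesis
    using fenchel_young[of "- v" "A *v y" "\<lambda>z. ereal (f z)"]
      fenchel_young[of "v v* A" y g]
    by (cases "g y"; cases ?F; cases ?H)
      (auto simp: dual_def primal_def transpose_matrix_vector dot_lmul_matrix)
qed

text \<open>The domain conditions give \<open>P x < \<infinity>\<close> and
  \<open>D u > -\<infinity>\<close>; weak duality \<open>D u \<le> P x\<close> supplies the other
  two bounds.\<close>

lemma primal_dual_finite:
  assumes "proper_fun g"
    and "x \<in> edom (primal A f g)" and "u \<in> edom (\<lambda>v. - dual A f g v)"
  obtains p d where "primal A f g x = ereal p" "dual A f g u = ereal d"
proof (cases "primal A f g x"; cases "dual A f g u")
  show thesis if "primal A f g x = ereal p" "dual A f g u = ereal d" for p d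
    using that by fact
qed (use assms weak_duality[OF assms(1), of A f u x] in \<open>auto simp: edom_def primal_def proper_fun_def\<close>)

text \<open>The gap is the sum of two Fenchel--Young gaps: the one for \<open>f\<close> carries the
  quadratic term, the one for \<open>g\<close> is nonnegative.\<close>

lemma duality_gap_lower_bound:
  assumes "proper_fun g"
    and "f differentiable_on UNIV" and "\<alpha> > 0"
    and "\<And>z z'. norm (grad f z - grad f z') \<le> (1 / \<alpha>) * norm (z - z')"
    and "x \<in> edom (primal A f g)" and "u \<in> edom (\<lambda>v. - dual A f g v)"
  shows "\<alpha> / 2 * (norm (u + grad f (A *v x)))\<^sup>2 \<le> duality_gap A f g x u"
proof -
  let ?F = "conjugate (\<lambda>z. ereal (f z)) (- u)" and ?H = "conjugate g (u v* A)"
  obtain p d where pd: "primal A f g x = ereal p" "dual A f g u = ereal d"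
    using primal_dual_finite[OF assms(1,5,6)] .
  have "?F \<noteq> -\<infinity>" "?H \<noteq> -\<infinity>"
    using conjugate_not_MInfty[OF assms(1)] conjugate_not_MInfty[of "\<lambda>z. ereal (f z)" "- u"]
    by (auto simp: proper_fun_def edom_def)
  with pd obtain F H where FH: "?F = ereal F" "?H = ereal H" "d = - F - H"
    by (cases ?F; cases ?H) (auto simp: dual_def transpose_matrix_vector)
  from pd obtain \<gamma> where \<gamma>: "g x = ereal \<gamma>" "p = f (A *v x) + \<gamma>"
    by (cases "g x") (auto simp: primal_def)
  have "norm (- u - grad f (A *v x)) = norm (u + grad f (A *v x))"
    by (metis norm_minus_cancel minus_add_distrib diff_conv_add_uminus)
  then have "\<alpha> / 2 * (norm (u + grad f (A *v x)))\<^sup>2 \<le> F + inner u (A *v x) + f (A *v x)"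
    using fenchel_young_smooth[OF assms(2-4), of "- u" "A *v x"] by (simp add: FH)
  moreover have "0 \<le> H - inner u (A *v x) + \<gamma>"
    using fenchel_young[of "u v* A" x g]
    by (simp add: FH \<gamma> dot_lmul_matrix)
  ultimately show ?thesis
    by (simp add: duality_gap_def pd FH \<gamma>)
qed

text \<open>By weak duality, the common value of \<open>P x\<close> and \<open>D u\<close> lies
  above all dual values and below all primal values.\<close>

lemma optimal_if_duality_gap_eq_0:
  assumes "proper_fun g"
    and "x \<in> edom (primal A f g)" and "u \<in> edom (\<lambda>v. - dual A f g v)"
    and "duality_gap A f g x u = 0"
  shows "primal A f g x \<le> primal A f g y" and "dual A f g v \<le> dual A f g u"
proof -
  obtain p d where pd: "primal A f g x = ereal p" "dual A f g u = ereal d"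
    using primal_dual_finite[OF assms(1-3)] .
  with assms(4) have "primal A f g x = dual A f g u"
    by (simp add: duality_gap_def)
  then show "primal A f g x \<le> primal A f g y" and "dual A f g v \<le> dual A f g u"
    using weak_duality[OF assms(1), of A f] by metis+
qed

theorem proposition4p5:
  fixes A :: "real^'n^'m"
    and f :: "real^'m \<Rightarrow> real"
    and g :: "real^'n \<Rightarrow> ereal"
    and \<alpha> :: real
    and x :: "real^'n"
    and u :: "real^'m"
  assumes "proper_fun (\<lambda>z. ereal (f z))" and "closed_fun (\<lambda>z. ereal (f z))"
    and "convex_fun (\<lambda>z. ereal (f z))"
    and "proper_fun g" and "closed_fun g" and "convex_fun g"
    and "\<alpha> > 0"
    and "f differentiable_on UNIV"
    and "\<forall>z z'. norm (grad f z - grad f z') \<le> (1 / \<alpha>) * norm (z - z')"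
    and "\<exists>x0. \<forall>y. primal A f g x0 \<le> primal A f g y"
    and "x \<in> edom (primal A f g)"
    and "u \<in> edom (\<lambda>v. - dual A f g v)"
  shows "ball_RYU A f g \<alpha> x u \<subseteq> cball (c_xGAP A f x) (r_xGAP A f g \<alpha> x u) \<and>
    (\<not> ((\<forall>y. primal A f g x \<le> primal A f g y) \<and> (\<forall>v. dual A f g v \<le> dual A f g u))
       \<longrightarrow> ball_RYU A f g \<alpha> x u \<subset> cball (c_xGAP A f x) (r_xGAP A f g \<alpha> x u))"
proof -
  define G where "G = duality_gap A f g x u"
  define a where "a = norm (u + grad f (A *v x)) / 2"
  define r where "r = r_RYU A f g \<alpha> x u"
  have a_nonneg: "0 \<le> a" by (simp add: a_def)
  have "\<alpha> / 2 * (norm (u + grad f (A *v x)))\<^sup>2 \<le> G"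
    unfolding G_def by (rule duality_gap_lower_bound) (use assms in auto)
  then have G: "2 * a\<^sup>2 \<le> G / \<alpha>"
    using \<open>\<alpha> > 0\<close> by (simp add: a_def field_simps power_divide)
  have r_sqrt: "r = sqrt (G / \<alpha> - a\<^sup>2)"
    by (simp add: r_def r_RYU_def G_def a_def power_divide)
  have radicand: "0 \<le> G / \<alpha> - a\<^sup>2"
    using G zero_le_power2[of a] by linarith
  have r_nonneg: "0 \<le> r" and r_square: "r\<^sup>2 = G / \<alpha> - a\<^sup>2"
    using radicand by (auto simp: r_sqrt)
  \<comment> \<open>Eliminating \<open>G\<close> leaves the larger radius in terms of
    \<open>a\<close> and \<open>r\<close> alone.\<close>
  have R: "r_xGAP A f g \<alpha> x u = sqrt (2 * (a\<^sup>2 + r\<^sup>2))"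
    by (simp add: r_xGAP_def r_square G_def)
  have "c_RYU A f x u - c_xGAP A f x = (1/2) *\<^sub>R (u + grad f (A *v x))"
    by (simp add: c_RYU_def c_xGAP_def vec_eq_iff field_simps)
  then have dist: "dist (c_RYU A f x u) (c_xGAP A f x) = a"
    by (simp add: dist_norm a_def)
  have "(a + r)\<^sup>2 \<le> 2 * (a\<^sup>2 + r\<^sup>2)"
    using sum_squares_bound[of a r] by (simp add: power2_sum)
  then have "a + r \<le> r_xGAP A f g \<alpha> x u"
    unfolding R by (rule real_le_rsqrt)
  then have sub: "ball_RYU A f g \<alpha> x u \<subseteq> cball (c_xGAP A f x) (r_xGAP A f g \<alpha> x u)"
    unfolding ball_RYU_def cball_subset_cball_iff by (simp add: dist r_def)
  have "G = 0" if eq: "ball_RYU A f g \<alpha> x u = cball (c_xGAP A f x) (r_xGAP A f g \<alpha> x u)"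
  proof -
    \<comment> \<open>\<open>r_nonneg\<close> excludes two empty balls, whose centers and radii need
      not agree.\<close>
    from eq r_nonneg have "c_RYU A f x u = c_xGAP A f x" "r = r_xGAP A f g \<alpha> x u"
      by (auto simp: ball_RYU_def cball_eq_cball_iff r_def)
    \<comment> \<open>With \<open>a = 0\<close> the larger radius is \<open>sqrt 2 * r\<close>, so
      equal radii force \<open>r = 0\<close> and hence \<open>G = 0\<close>.\<close>
    with dist R have "a = 0" "r = sqrt (2 * r\<^sup>2)" by auto
    then have "r\<^sup>2 = 2 * r\<^sup>2"
      by (metis real_sqrt_pow2 zero_le_power2 mult_nonneg_nonneg zero_le_numeral)
    then show ?thesis
      using r_square \<open>a = 0\<close> \<open>\<alpha> > 0\<close> by simp
  qed
  moreover have "(\<forall>y. primal A f g x \<le> primal A f g y) \<and> (\<forall>v. dual A f g v \<le> dual A f g u)"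
    if "G = 0"
    using optimal_if_duality_gap_eq_0[OF assms(4,11,12)] that by (simp add: G_def)
  ultimately show ?thesis
    using sub by blast
qed

end
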